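(* For integers $n,k$ with $2\leq k\leq n-2$, $fsmp(S_{n,k})=fmp(S_{n,k})=n-1$.
   Context: The $(n,k)$-star graph $S_{n,k}$ ($1\leq k\leq n-1$) has as vertices all sequences $a_1a_2\ldots a_k$ of $k$ distinct elements of $\{1,\dots,n\}$; $a_1\ldots a_k$ and $b_1\ldots b_k$ are adjacent iff either (1) $b_1\ldots b_k$ is obtained from $a_1\ldots a_k$ by swapping $a_1$ and $a_s$ for some $2\leq s\leq k$, or (2) $a_i=b_i$ for all $2\leq i\leq k$ and $a_1\neq b_1$ (i.e. $a_1$ is replaced by an element of $\{1,\dots,n\}\setminus\{a_1,\dots,a_k\}$). A fractional perfect matching of $G$ is $g:E(G)\to[0,1]$ with $\sum_{e\ni v}g(e)=1$ for all $v$. $fmp(G)$ (resp. $fsmp(G)$) is the minimum size of a set $F\subseteq E(G)$ (resp. $F\subseteq V(G)\cup E(G)$) whose deletion (vertices with incident edges, and edges) leaves a graph with no fractional perfect matching. *)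

theory Defs
  imports Complex_Main
begin

record 'a ugraph =
  verts :: "'a set"
  edges :: "'a set set"

definition delete_elems :: "'a ugraph \<Rightarrow> 'a set \<Rightarrow> 'a set set \<Rightarrow> 'a ugraph" where
  "delete_elems G X Y =
     \<lparr>verts = verts G - X, edges = {e \<in> edges G. e \<notin> Y \<and> e \<inter> X = {}}\<rparr>"

definition fractional_perfect_matching :: "'a ugraph \<Rightarrow> ('a set \<Rightarrow> real) \<Rightarrow> bool" where
  "fractional_perfect_matching G g \<longleftrightarrow>
     (\<forall>e\<in>edges G. 0 \<le> g e \<and> g e \<le> 1) \<and>
     (\<forall>v\<in>verts G. (\<Sum>e | e \<in> edges G \<and> v \<in> e. g e) = 1)"

definition has_fractional_perfect_matching :: "'a ugraph \<Rightarrow> bool" where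
  "has_fractional_perfect_matching G \<longleftrightarrow> (\<exists>g. fractional_perfect_matching G g)"

definition fmp :: "'a ugraph \<Rightarrow> nat" where
  "fmp G = (LEAST m. \<exists>F. F \<subseteq> edges G \<and> finite F \<and> card F = m \<and>
     \<not> has_fractional_perfect_matching (delete_elems G {} F))"

text \<open>A set of vertices and edges is a subset \<open>F\<close> of the disjoint sum of the two sets;
  \<open>Inl -` F\<close> are its vertices and \<open>Inr -` F\<close> its edges.\<close>

definition fsmp :: "'a ugraph \<Rightarrow> nat" where
  "fsmp G = (LEAST m. \<exists>F. F \<subseteq> verts G <+> edges G \<and> finite F \<and> card F = m \<and>
     \<not> has_fractional_perfect_matching (delete_elems G (Inl -` F) (Inr -` F)))"

definition nk_star_verts :: "nat \<Rightarrow> nat \<Rightarrow> nat list set" where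
  "nk_star_verts n k = {a. length a = k \<and> distinct a \<and> set a \<subseteq> {1..n}}"

text \<open>Lists are indexed from 0, so the symbol $a_i$ is \<open>a ! (i - 1)\<close>: the distinguished first
  position is index 0, and the positions $2, \ldots, k$ are the indices in \<open>{1..<k}\<close>.\<close>

definition nk_star_adj :: "nat \<Rightarrow> nat list \<Rightarrow> nat list \<Rightarrow> bool" where
  "nk_star_adj k a b \<longleftrightarrow>
     (\<exists>s\<in>{1..<k}. b = a[0 := a ! s, s := a ! 0]) \<or>
     (\<forall>i\<in>{1..<k}. a ! i = b ! i) \<and> a ! 0 \<noteq> b ! 0"

definition nk_star_graph :: "nat \<Rightarrow> nat \<Rightarrow> nat list ugraph" where
  "nk_star_graph n k =
     \<lparr>verts = nk_star_verts n k,
      edges = {{a, b} |a b. a \<in> nk_star_verts n k \<and> b \<in> nk_star_verts n k \<and> nk_star_adj k a b}\<rparr>"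

end

theory Submission
  imports Defs
begin

text \<open>
  Deleting the \<open>n - 1\<close> edges at a vertex isolates it, which gives the upper bounds. For the lower
  bound we partition what survives \<open>n - 2\<close> faults into edges (of weight 1) and triangles (of weight
  1/2 per edge), by induction on the number of positions that are not yet fixed. Fixing the symbol at
  a further position \<open>j\<close> splits the graph into smaller star graphs. If for every \<open>j\<close> some part has
  more faults than the induction hypothesis allows, then this part contains all faults; as the first
  position is the only one never fixed, all faults lie in a single clique. In that case the
  survivors of the clique are matched outwards, into distinct other cliques.

  In the base case \<open>k = 2\<close> the vertices are the arcs of a complete digraph, an arc being adjacent to
  its reversal and to the arcs with the same head. A clique (of arcs with a common head) with \<open>m\<close>
  vertices tolerates \<open>m - 3\<close> faults; the only other distribution has one clique with all faults but
  one, and there all but at most two survivors are matched outwards (with a detour for \<open>n = 4\<close>).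
\<close>

subsection \<open>Covers by edges and triangles\<close>

inductive edge_triangle_cover :: "'a set set \<Rightarrow> 'a set \<Rightarrow> bool" for E where
  empty: "edge_triangle_cover E {}"
| edge: "edge_triangle_cover E W \<Longrightarrow> {x, y} \<in> E \<Longrightarrow> x \<noteq> y \<Longrightarrow> {x, y} \<inter> W = {} \<Longrightarrow>
    edge_triangle_cover E ({x, y} \<union> W)"
| triangle: "edge_triangle_cover E W \<Longrightarrow> {x, y} \<in> E \<Longrightarrow> {y, z} \<in> E \<Longrightarrow> {x, z} \<in> E \<Longrightarrow>
    x \<noteq> y \<Longrightarrow> y \<noteq> z \<Longrightarrow> x \<noteq> z \<Longrightarrow> {x, y, z} \<inter> W = {} \<Longrightarrow>
    edge_triangle_cover E ({x, y, z} \<union> W)"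

text \<open>Edges of the partition get weight 1, triangle edges 1/2. That \<open>g\<close> vanishes
  on every edge not inside \<open>W\<close> makes the induction work: a new piece is disjoint from
  \<open>W\<close>, so it neither disturbs the old sums nor receives old weight.\<close>

lemma edge_triangle_cover_imp_weights:
  assumes "edge_triangle_cover E W" "finite E"
  shows "\<exists>g :: 'a set \<Rightarrow> real. (\<forall>e. 0 \<le> g e \<and> g e \<le> 1) \<and> (\<forall>e. g e \<noteq> 0 \<longrightarrow> e \<in> E \<and> e \<subseteq> W) \<and>
    (\<forall>v\<in>W. (\<Sum>e | e \<in> E \<and> v \<in> e. g e) = 1)"
  using assms(1)
proof induction
  case empty
  show ?case by (intro exI[of _ "\<lambda>_. 0"]) auto
next
  case (edge W x y)
  then obtain g :: "'a set \<Rightarrow> real" where g: "\<forall>e. 0 \<le> g e \<and> g e \<le> 1"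
    "\<forall>e. g e \<noteq> 0 \<longrightarrow> e \<in> E \<and> e \<subseteq> W" "\<forall>v\<in>W. (\<Sum>e | e \<in> E \<and> v \<in> e. g e) = 1" by blast
  let ?g = "\<lambda>e. if e = {x, y} then 1 else g e"
  have "(\<Sum>e | e \<in> E \<and> v \<in> e. ?g e) = 1" if "v \<in> W" for v
  proof -
    have "(\<Sum>e | e \<in> E \<and> v \<in> e. ?g e) = (\<Sum>e | e \<in> E \<and> v \<in> e. g e)"
      using that edge.hyps by (intro sum.cong) auto
    then show ?thesis using g that by simp
  qed
  moreover have "(\<Sum>e | e \<in> E \<and> v \<in> e. ?g e) = 1" if "v \<in> {x, y}" for v
  proof -
    have "(\<Sum>e | e \<in> E \<and> v \<in> e. ?g e) = (\<Sum>e\<in>{{x, y}}. ?g e)"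
      using that edge.hyps g(2) assms(2) by (intro sum.mono_neutral_right) auto
    then show ?thesis by simp
  qed
  ultimately show ?case using g edge.hyps by (intro exI[of _ ?g]) auto
next
  case (triangle W x y z)
  then obtain g :: "'a set \<Rightarrow> real" where g: "\<forall>e. 0 \<le> g e \<and> g e \<le> 1"
    "\<forall>e. g e \<noteq> 0 \<longrightarrow> e \<in> E \<and> e \<subseteq> W" "\<forall>v\<in>W. (\<Sum>e | e \<in> E \<and> v \<in> e. g e) = 1" by blast
  let ?T = "{{x, y}, {y, z}, {x, z}}"
  let ?g = "\<lambda>e. if e \<in> ?T then 1 / 2 else g e"
  have "(\<Sum>e | e \<in> E \<and> v \<in> e. ?g e) = 1" if "v \<in> W" for v
  proof -
    have "(\<Sum>e | e \<in> E \<and> v \<in> e. ?g e) = (\<Sum>e | e \<in> E \<and> v \<in> e. g e)"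
      using that triangle.hyps by (intro sum.cong) auto
    then show ?thesis using g that by simp
  qed
  moreover have "(\<Sum>e | e \<in> E \<and> v \<in> e. ?g e) = 1" if v: "v \<in> {x, y, z}" for v
  proof -
    \<comment> \<open>Old weights vanish at \<open>v\<close>, so only the two triangle edges through
      \<open>v\<close> count, each with weight 1/2.\<close>
    have "(\<Sum>e | e \<in> E \<and> v \<in> e. ?g e) = (\<Sum>e\<in>{e \<in> ?T. v \<in> e}. ?g e)"
    proof (rule sum.mono_neutral_right)
      have "g e = 0" if "e \<in> E" "v \<in> e" for e
        using that v triangle.hyps g(2) by blast
      then show "\<forall>e\<in>{e \<in> E. v \<in> e} - {e \<in> ?T. v \<in> e}. ?g e = 0" by auto
    qed (use triangle.hyps assms(2) in auto)
    also have "\<dots> = (\<Sum>e\<in>{e \<in> ?T. v \<in> e}. 1 / 2)"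
      by (intro sum.cong) auto
    also have "\<dots> = card {e \<in> ?T. v \<in> e} / 2" by simp
    also have "card {e \<in> ?T. v \<in> e} = 2"
    proof -
      consider "v = x" | "v = y" | "v = z" using v by auto
      then show ?thesis
      proof cases
        case 1
        then have "{e \<in> ?T. v \<in> e} = {{x, y}, {x, z}}" using triangle.hyps by auto
        then show ?thesis using triangle.hyps by (simp add: doubleton_eq_iff)
      next
        case 2
        then have "{e \<in> ?T. v \<in> e} = {{x, y}, {y, z}}" using triangle.hyps by auto
        then show ?thesis using triangle.hyps by (simp add: doubleton_eq_iff)
      next
        case 3
        then have "{e \<in> ?T. v \<in> e} = {{y, z}, {x, z}}" using triangle.hyps by auto
        then show ?thesis using triangle.hyps by (simp add: doubleton_eq_iff)
      qed
    qed
    finally show ?thesis by simp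
  qed
  moreover have "0 \<le> ?g e \<and> ?g e \<le> 1" for e using g(1) by simp
  moreover have "e \<in> E \<and> e \<subseteq> {x, y, z} \<union> W" if "?g e \<noteq> 0" for e
  proof (cases "e \<in> ?T")
    case True
    then show ?thesis using triangle.hyps by blast
  next
    case False
    then have "e \<in> E \<and> e \<subseteq> W" using that g(2) by simp
    then show ?thesis by blast
  qed
  ultimately show ?case by (intro exI[of _ ?g]) blast
qed

lemma edge_triangle_cover_Un:
  assumes "edge_triangle_cover E A" "edge_triangle_cover E B" "A \<inter> B = {}"
  shows "edge_triangle_cover E (A \<union> B)"
  using assms(1,3)
proof induction
  case empty
  then show ?case using assms(2) by simp
next
  case (edge W x y)
  then have "edge_triangle_cover E ({x, y} \<union> (W \<union> B))"
    by (intro edge_triangle_cover.edge) auto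
  then show ?case by (simp add: Un_assoc)
next
  case (triangle W x y z)
  then have "edge_triangle_cover E ({x, y, z} \<union> (W \<union> B))"
    by (intro edge_triangle_cover.triangle) auto
  then show ?case by (simp add: Un_assoc)
qed

lemma edge_triangle_cover_UN:
  assumes "finite I" "\<And>i. i \<in> I \<Longrightarrow> edge_triangle_cover E (A i)"
    "\<And>i j. i \<in> I \<Longrightarrow> j \<in> I \<Longrightarrow> i \<noteq> j \<Longrightarrow> A i \<inter> A j = {}"
  shows "edge_triangle_cover E (\<Union>i\<in>I. A i)"
  using assms
proof (induction I rule: finite_induct)
  case empty
  show ?case by (simp add: edge_triangle_cover.empty)
next
  case (insert i I)
  have "A i \<inter> (\<Union>i\<in>I. A i) = {}" using insert.hyps insert.prems(2) by fastforce
  then show ?case using insert by (auto intro!: edge_triangle_cover_Un)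
qed

text \<open>Carries a cover of the arc graph over to a block of the star graph.\<close>

lemma edge_triangle_cover_image:
  assumes "edge_triangle_cover E W" "inj_on f W" "\<And>e. e \<in> E \<Longrightarrow> e \<subseteq> W \<Longrightarrow> f ` e \<in> E'"
  shows "edge_triangle_cover E' (f ` W)"
  using assms
proof induction
  case empty
  show ?case by (simp add: edge_triangle_cover.empty)
next
  case (edge W x y)
  have "edge_triangle_cover E' ({f x, f y} \<union> f ` W)"
  proof (rule edge_triangle_cover.edge)
    show "edge_triangle_cover E' (f ` W)"
      using edge.prems by (intro edge.IH) (auto simp: inj_on_Un)
    show "{f x, f y} \<in> E'" using edge.prems(2)[of "{x, y}"] edge.hyps by auto
    show "f x \<noteq> f y" "{f x, f y} \<inter> f ` W = {}"
      using edge.prems(1) edge.hyps by (auto simp: inj_on_def)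
  qed
  then show ?case by (simp add: image_Un)
next
  case (triangle W x y z)
  have "edge_triangle_cover E' ({f x, f y, f z} \<union> f ` W)"
  proof (rule edge_triangle_cover.triangle)
    show "edge_triangle_cover E' (f ` W)"
      using triangle.prems by (intro triangle.IH) (auto simp: inj_on_Un)
    show "{f x, f y} \<in> E'" using triangle.prems(2)[of "{x, y}"] triangle.hyps by auto
    show "{f y, f z} \<in> E'" using triangle.prems(2)[of "{y, z}"] triangle.hyps by auto
    show "{f x, f z} \<in> E'" using triangle.prems(2)[of "{x, z}"] triangle.hyps by auto
    show "f x \<noteq> f y" "f y \<noteq> f z" "f x \<noteq> f z" "{f x, f y, f z} \<inter> f ` W = {}"
      using triangle.prems(1) triangle.hyps by (auto simp: inj_on_def)
  qed
  then show ?case by (simp add: image_Un)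
qed

lemma edge_triangle_cover_pair:
  "{x, y} \<in> E \<Longrightarrow> x \<noteq> y \<Longrightarrow> edge_triangle_cover E {x, y}"
  using edge_triangle_cover.edge[OF edge_triangle_cover.empty, of x y E] by simp

text \<open>Pairs are split off until an edge or a triangle is left.\<close>

lemma edge_triangle_cover_clique:
  assumes "finite W" "2 \<le> card W" "\<And>x y. x \<in> W \<Longrightarrow> y \<in> W \<Longrightarrow> x \<noteq> y \<Longrightarrow> {x, y} \<in> E"
  shows "edge_triangle_cover E W"
  using assms
proof (induction "card W" arbitrary: W rule: less_induct)
  case less
  consider "card W = 2" | "card W = 3" | "4 \<le> card W" using less.prems(2) by linarith
  then show ?case
  proof cases
    case 1
    then obtain x y where "W = {x, y}" "x \<noteq> y" by (auto simp: card_2_iff)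
    then show ?thesis using less.prems(3) by (auto intro: edge_triangle_cover_pair)
  next
    case 2
    then obtain x y z where W: "W = {x, y, z}" "x \<noteq> y" "y \<noteq> z" "x \<noteq> z"
      by (auto simp: card_3_iff)
    have "edge_triangle_cover E ({x, y, z} \<union> {})"
      using W less.prems(3) by (intro edge_triangle_cover.triangle edge_triangle_cover.empty) auto
    then show ?thesis using W by simp
  next
    case 3
    obtain x where x: "x \<in> W" using 3 by fastforce
    have "card (W - {x}) \<ge> 3" using 3 x less.prems(1) by simp
    then have "W - {x} \<noteq> {}" by (metis card.empty not_numeral_le_zero)
    then obtain y where y: "y \<in> W" "y \<noteq> x" by blast
    have c: "card (W - {x, y}) = card W - 2" using x y less.prems(1) by (simp add: card_Diff_subset)
    have "edge_triangle_cover E ({x, y} \<union> (W - {x, y}))"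
    proof (rule edge_triangle_cover.edge)
      show "edge_triangle_cover E (W - {x, y})"
        by (rule less.hyps) (use c 3 less.prems in auto)
    qed (use x y less.prems in auto)
    moreover have "{x, y} \<union> (W - {x, y}) = W" using x y by auto
    ultimately show ?thesis by simp
  qed
qed

text \<open>Here \<open>M\<close> collects the missing pairs. The induction splits off a present
  edge \<open>{x, u}\<close> that meets at least two members of \<open>M\<close>, so
  \<open>card W\<close> drops by 2 and \<open>card M\<close> by at least 2. If there is no such
  edge, one pair can be split off that leaves a clique.\<close>

lemma edge_triangle_cover_near_clique:
  assumes "finite W" "finite M" "card M + 3 \<le> card W"
    "\<And>x y. x \<in> W \<Longrightarrow> y \<in> W \<Longrightarrow> x \<noteq> y \<Longrightarrow> {x, y} \<notin> M \<Longrightarrow> {x, y} \<in> E"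
  shows "edge_triangle_cover E W"
  using assms
proof (induction "card W" arbitrary: W M rule: less_induct)
  case less
  note fin = less.prems(1,2)
  show ?case
  proof (cases "\<exists>x y. x \<in> W \<and> y \<in> W \<and> x \<noteq> y \<and> {x, y} \<in> M")
    case False
    then show ?thesis using less.prems by (intro edge_triangle_cover_clique) auto
  next
    case True
    then obtain x y where xy: "x \<in> W" "y \<in> W" "x \<noteq> y" "{x, y} \<in> M" by blast
    have cM: "card M \<ge> 1" using xy(4) fin by (metis One_nat_def Suc_leI card_gt_0_iff empty_iff)
    have red: "edge_triangle_cover E W"
      if u: "u \<in> W" "u \<noteq> x" "{x, u} \<notin> M" "edge_triangle_cover E (W - {x, u})" for u
    proof -
      have "edge_triangle_cover E ({x, u} \<union> (W - {x, u}))"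
        by (rule edge_triangle_cover.edge) (use u xy less.prems(4) in auto)
      moreover have "{x, u} \<union> (W - {x, u}) = W" using u xy by auto
      ultimately show ?thesis by simp
    qed
    have c: "card (W - {x, u}) = card W - 2" if "u \<in> W" "u \<noteq> x" for u
      using that xy fin by (simp add: card_Diff_subset)
    have step: "edge_triangle_cover E (W - {x, u})"
      if u: "u \<in> W" "u \<noteq> x" and e: "e \<in> M" "e \<noteq> {x, y}" "x \<in> e \<or> u \<in> e" for u e
    proof -
      let ?M = "M - {{x, y}, e}"
      have "card ?M = card M - 2" "card M \<ge> 2"
        using xy e fin card_mono[of M "{{x, y}, e}"] by (auto simp: card_Diff_subset)
      then show ?thesis
        using c[OF u] less.prems u xy e
        by (intro less.hyps[of _ ?M]) auto
    qed
    show ?thesis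
    proof (cases "\<exists>e\<in>M. e \<noteq> {x, y} \<and> x \<in> e")
      case True
      then obtain e where e: "e \<in> M" "e \<noteq> {x, y}" "x \<in> e" by blast
      \<comment> \<open>If all pairs at \<open>x\<close> were missing, \<open>M\<close> would have
        at least \<open>card W - 1\<close> members.\<close>
      have "\<exists>u\<in>W - {x}. {x, u} \<notin> M"
      proof (rule ccontr)
        assume "\<not> ?thesis"
        then have "(\<lambda>u. {x, u}) ` (W - {x}) \<subseteq> M" by auto
        moreover have "inj_on (\<lambda>u. {x, u}) (W - {x})" by (auto simp: inj_on_def doubleton_eq_iff)
        ultimately have "card (W - {x}) \<le> card M" using fin by (metis card_inj_on_le)
        then show False using less.prems(3) xy fin by simp
      qed
      then obtain u where "u \<in> W" "u \<noteq> x" "{x, u} \<notin> M" by blast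
      then show ?thesis using red step e by blast
    next
      \<comment> \<open>Now \<open>{x, y}\<close> is the only missing pair at \<open>x\<close>, so
        every \<open>u\<close> other than \<open>y\<close> is a possible partner of
        \<open>x\<close>.\<close>
      case F1: False
      show ?thesis
      proof (cases "\<exists>e\<in>M. e \<noteq> {x, y} \<and> (\<exists>u\<in>e. u \<in> W - {x, y})")
        case True
        then obtain e u where e: "e \<in> M" "e \<noteq> {x, y}" "u \<in> e" "u \<in> W - {x, y}" by blast
        then have "{x, u} \<notin> M" using F1 by (metis DiffE doubleton_eq_iff insertI1 insertI2)
        then show ?thesis using red[of u] step[of u e] e by blast
      next
        \<comment> \<open>Now \<open>{x, y}\<close> is the only missing pair inside
          \<open>W\<close>, so removing \<open>x\<close> with any partner leaves a clique.\<close>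
        case F2: False
        have "card (W - {x, y}) \<ge> 2" using c[OF xy(2)] xy(3) less.prems(3) cM by simp
        then obtain u where u: "u \<in> W - {x, y}"
          by (metis card.empty ex_in_conv not_numeral_le_zero)
        have "{x, u} \<notin> M" using F1 u by (metis DiffE doubleton_eq_iff insertI1 insertI2)
        moreover have "edge_triangle_cover E (W - {x, u})"
        proof (rule edge_triangle_cover_clique)
          show "2 \<le> card (W - {x, u})" using c[of u] u less.prems(3) cM by simp
          show "{p, q} \<in> E" if pq: "p \<in> W - {x, u}" "q \<in> W - {x, u}" "p \<noteq> q" for p q
          proof (rule less.prems(4))
            show "{p, q} \<notin> M"
            proof
              assume "{p, q} \<in> M"
              moreover have "{p, q} \<noteq> {x, y}" using pq by (auto simp: doubleton_eq_iff)
              ultimately have "r \<in> {x, y}" if "r \<in> {p, q}" "r \<in> W" for r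
                using F2 that by (metis DiffI)
              from this[of p] this[of q] show False using pq by auto
            qed
          qed (use pq in auto)
        qed (use fin in auto)
        ultimately show ?thesis using red[of u] u by blast
      qed
    qed
  qed
qed

subsection \<open>Arcs of a complete digraph\<close>

definition arcs :: "'a set \<Rightarrow> ('a \<times> 'a) set" where
  "arcs S = {(x, y). x \<in> S \<and> y \<in> S \<and> x \<noteq> y}"

text \<open>On the vertices \<open>arcs S\<close> this is the star graph with \<open>k = 2\<close>
  over the symbols \<open>S\<close>, with the tail at the first position and the head at the second.
  The first set holds the replacements, the second the swaps.\<close>

definition arc_edges :: "'a set \<Rightarrow> ('a \<times> 'a) set set" where
  "arc_edges S =
     {{(x, c), (y, c)} |x y c. x \<in> S \<and> y \<in> S \<and> c \<in> S \<and> x \<noteq> y \<and> x \<noteq> c \<and> y \<noteq> c} \<union>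
     {{(x, y), (y, x)} |x y. x \<in> S \<and> y \<in> S \<and> x \<noteq> y}"

lemma same_head_arc_edge:
  "x \<in> S \<Longrightarrow> y \<in> S \<Longrightarrow> c \<in> S \<Longrightarrow> x \<noteq> y \<Longrightarrow> x \<noteq> c \<Longrightarrow> y \<noteq> c \<Longrightarrow> {(x, c), (y, c)} \<in> arc_edges S"
  unfolding arc_edges_def by blast

lemma reversal_arc_edge:
  "x \<in> S \<Longrightarrow> y \<in> S \<Longrightarrow> x \<noteq> y \<Longrightarrow> {(x, y), (y, x)} \<in> arc_edges S"
  unfolding arc_edges_def by blast

lemma finite_arcs: "finite S \<Longrightarrow> finite (arcs S)"
  by (rule finite_subset[of _ "S \<times> S"]) (auto simp: arcs_def)

lemma arc_edges_subset: "e \<in> arc_edges S \<Longrightarrow> e \<subseteq> arcs S"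
  unfolding arc_edges_def arcs_def by auto

lemma finite_arc_edges: "finite S \<Longrightarrow> finite (arc_edges S)"
  using arc_edges_subset finite_subset[of "arc_edges S" "Pow (arcs S)"] finite_arcs by blast

lemma arc_edges_cases:
  assumes "e \<in> arc_edges S"
  obtains (same_head) x y c where "e = {(x, c), (y, c)}" "x \<in> S" "y \<in> S" "c \<in> S" "x \<noteq> y" "x \<noteq> c" "y \<noteq> c"
  | (reversal) x y where "e = {(x, y), (y, x)}" "x \<in> S" "y \<in> S" "x \<noteq> y"
  using assms unfolding arc_edges_def by blast

lemma arc_cover_same_head:
  assumes "finite S" "d \<in> S" "R \<subseteq> S - {d}" "2 \<le> card R"
    "\<And>x y. x \<in> R \<Longrightarrow> y \<in> R \<Longrightarrow> x \<noteq> y \<Longrightarrow> {(x, d), (y, d)} \<notin> Y"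
  shows "edge_triangle_cover (arc_edges S - Y) ((\<lambda>x. (x, d)) ` R)"
proof (rule edge_triangle_cover_clique)
  show "2 \<le> card ((\<lambda>x. (x, d)) ` R)" using assms(4) by (subst card_image) (auto simp: inj_on_def)
  show "finite ((\<lambda>x. (x, d)) ` R)" using assms(1,3) by (meson finite_Diff finite_imageI finite_subset)
qed (use assms in \<open>auto intro!: same_head_arc_edge\<close>)

lemma arc_cover_near_same_head:
  assumes "finite S" "d \<in> S" "R \<subseteq> S - {d}" "finite Y"
    and c: "card {e \<in> Y. e \<subseteq> UNIV \<times> {d}} + 3 \<le> card R"
  shows "edge_triangle_cover (arc_edges S - Y) ((\<lambda>x. (x, d)) ` R)"
proof (rule edge_triangle_cover_near_clique)
  have "card ((\<lambda>x. (x, d)) ` R) = card R" by (subst card_image) (auto simp: inj_on_def)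
  then show "card {e \<in> Y. e \<subseteq> UNIV \<times> {d}} + 3 \<le> card ((\<lambda>x. (x, d)) ` R)" using c by simp
  show "finite ((\<lambda>x. (x, d)) ` R)" using assms(1,3) by (meson finite_Diff finite_imageI finite_subset)
qed (use assms in \<open>auto intro!: same_head_arc_edge\<close>)

text \<open>Assembles a cover from the cliques of common head. Survivors \<open>(x, c)\<close> with
  \<open>x\<close> in \<open>T\<close> are matched outwards with their reversals
  \<open>(c, x)\<close>. These have distinct heads, so every other clique gives up at most one
  vertex, and the remainders of all cliques are covered separately.\<close>

lemma arc_cover:
  assumes "finite S" "c \<in> S" "T \<subseteq> S - {c}"
    and T: "\<And>x. x \<in> T \<Longrightarrow> (x, c) \<notin> X \<and> (c, x) \<notin> X \<and> {(x, c), (c, x)} \<notin> Y"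
    and c: "edge_triangle_cover (arc_edges S - Y) ((\<lambda>x. (x, c)) ` {x \<in> S - {c} - T. (x, c) \<notin> X})"
    and d: "\<And>d. d \<in> S - {c} \<Longrightarrow> edge_triangle_cover (arc_edges S - Y)
      ((\<lambda>x. (x, d)) ` {x \<in> S - {d}. (x, d) \<notin> X \<and> \<not> (d \<in> T \<and> x = c)})"
  shows "edge_triangle_cover (arc_edges S - Y) (arcs S - X)"
proof -
  let ?E = "arc_edges S - Y"
  let ?C = "(\<lambda>x. (x, c)) ` {x \<in> S - {c} - T. (x, c) \<notin> X}"
  let ?D = "\<lambda>d. (\<lambda>x. (x, d)) ` {x \<in> S - {d}. (x, d) \<notin> X \<and> \<not> (d \<in> T \<and> x = c)}"
  let ?P = "\<lambda>x. {(x, c), (c, x)}"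
  have "edge_triangle_cover ?E (\<Union>x\<in>T. ?P x)"
  proof (rule edge_triangle_cover_UN)
    show "finite T" using assms(1,3) finite_subset by blast
    show "edge_triangle_cover ?E (?P x)" if "x \<in> T" for x
    proof (rule edge_triangle_cover_pair)
      show "?P x \<in> ?E" using T[OF that] assms(2,3) that reversal_arc_edge[of x S c] by auto
    qed (use that assms(3) in auto)
  qed (use assms(3) in auto)
  moreover have "edge_triangle_cover ?E (\<Union>d\<in>S - {c}. ?D d)"
    by (rule edge_triangle_cover_UN) (use assms(1) d in auto)
  ultimately have "edge_triangle_cover ?E ((\<Union>x\<in>T. ?P x) \<union> (\<Union>d\<in>S - {c}. ?D d))"
    by (rule edge_triangle_cover_Un) (use assms(3) in auto)
  then have "edge_triangle_cover ?E (((\<Union>x\<in>T. ?P x) \<union> (\<Union>d\<in>S - {c}. ?D d)) \<union> ?C)"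
    by (rule edge_triangle_cover_Un[OF _ c]) (use assms(3) in auto)
  moreover have "((\<Union>x\<in>T. ?P x) \<union> (\<Union>d\<in>S - {c}. ?D d)) \<union> ?C = arcs S - X"
  proof (rule set_eqI)
    fix p :: "'a \<times> 'a"
    obtain x y where p: "p = (x, y)" by fastforce
    show "p \<in> ((\<Union>x\<in>T. ?P x) \<union> (\<Union>d\<in>S - {c}. ?D d)) \<union> ?C \<longleftrightarrow> p \<in> arcs S - X"
      using assms(2,3) T unfolding p arcs_def by (cases "y = c"; cases "x = c") auto
  qed
  ultimately show ?thesis by simp
qed

text \<open>The reversal edges form a perfect matching. The linear order selects one arc from each
  pair, which indexes the pairs without repetition.\<close>

lemma arc_cover_reversals:
  fixes S :: "'a::linorder set"
  assumes "finite S" "\<And>x y. x \<in> S \<Longrightarrow> y \<in> S \<Longrightarrow> x \<noteq> y \<Longrightarrow> {(x, y), (y, x)} \<notin> Y"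
  shows "edge_triangle_cover (arc_edges S - Y) (arcs S)"
proof -
  let ?I = "{p \<in> arcs S. fst p < snd p}"
  have "edge_triangle_cover (arc_edges S - Y) (\<Union>p\<in>?I. {p, prod.swap p})"
  proof (rule edge_triangle_cover_UN)
    show "edge_triangle_cover (arc_edges S - Y) {p, prod.swap p}" if "p \<in> ?I" for p
      using that assms(2) by (intro edge_triangle_cover_pair) (auto simp: arcs_def reversal_arc_edge)
  qed (use finite_arcs[OF assms(1)] in \<open>auto simp: arcs_def\<close>)
  moreover have "(\<Union>p\<in>?I. {p, prod.swap p}) = arcs S"
  proof (rule set_eqI)
    fix p :: "'a \<times> 'a"
    obtain x y where p: "p = (x, y)" by fastforce
    show "p \<in> (\<Union>p\<in>?I. {p, prod.swap p}) \<longleftrightarrow> p \<in> arcs S"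
      using less_linear[of x y] unfolding p arcs_def by (auto simp: image_iff)
  qed
  ultimately show ?thesis by simp
qed

text \<open>All survivors with head \<open>c\<close> are matched outwards. The other cliques are
  free of faults and keep at least \<open>card S - 2\<close> vertices.\<close>

lemma arc_cover_one_head:
  assumes "finite S" "4 \<le> card S"
    and Xc: "X \<subseteq> arcs S \<inter> UNIV \<times> {c}" and Yc: "\<And>e. e \<in> Y \<Longrightarrow> e \<subseteq> UNIV \<times> {c}"
  shows "edge_triangle_cover (arc_edges S - Y) (arcs S - X)"
proof -
  \<comment> \<open>The head \<open>c\<close> may lie outside \<open>S\<close>; then
    \<open>X\<close> is empty and any symbol of \<open>S\<close> can take its place.\<close>
  obtain c' where c': "c' \<in> S" "c \<in> S \<Longrightarrow> c' = c"
    using assms(2) by (metis all_not_in_conv card.empty not_numeral_le_zero)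
  have X: "X \<subseteq> UNIV \<times> {c'}" using Xc c' by (auto simp: arcs_def)
  let ?T = "{x \<in> S - {c'}. (x, c') \<notin> X}"
  show ?thesis
  proof (rule arc_cover[OF assms(1) c'(1), of ?T])
    show "(x, c') \<notin> X \<and> (c', x) \<notin> X \<and> {(x, c'), (c', x)} \<notin> Y" if "x \<in> ?T" for x
      using that X Yc[of "{(x, c'), (c', x)}"] by auto
    have "{x \<in> S - {c'} - ?T. (x, c') \<notin> X} = {}" by auto
    then show "edge_triangle_cover (arc_edges S - Y)
       ((\<lambda>x. (x, c')) ` {x \<in> S - {c'} - ?T. (x, c') \<notin> X})"
      by (simp only: image_empty edge_triangle_cover.empty)
    fix d assume d: "d \<in> S - {c'}"
    let ?R = "{x \<in> S - {d}. (x, d) \<notin> X \<and> \<not> (d \<in> ?T \<and> x = c')}"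
    show "edge_triangle_cover (arc_edges S - Y) ((\<lambda>x. (x, d)) ` ?R)"
    proof (rule arc_cover_same_head[OF assms(1)])
      have "S - {d, c'} \<subseteq> ?R" using X d by auto
      then have "card (S - {d, c'}) \<le> card ?R" using assms(1) by (intro card_mono) auto
      moreover have "card (S - {d, c'}) = card S - 2"
        using d c' assms(1) by (simp add: card_Diff_subset)
      ultimately show "2 \<le> card ?R" using assms(2) by simp
      show "{(x, d), (y, d)} \<notin> Y" if "x \<in> ?R" "y \<in> ?R" "x \<noteq> y" for x y
        using Yc[of "{(x, d), (y, d)}"] d c' that by auto
    qed (use d in auto)
  qed auto
qed

text \<open>The clique of \<open>d\<close> is covered on its own and must not lose
  \<open>(c, d)\<close> to an outward match. Hence \<open>(d, c)\<close>, if it survives, is paired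
  with some \<open>(w, c)\<close> inside its own clique, and the other survivors with head
  \<open>c\<close> are matched outwards.\<close>

lemma arc_cover_two_heads:
  assumes S: "finite S" "4 \<le> card S" and cd: "c \<in> S" "d \<in> S" "c \<noteq> d"
    and fin: "finite X" "finite Y"
    and c: "card (X \<inter> UNIV \<times> {c}) + card {e \<in> Y. e \<subseteq> UNIV \<times> {c}} + 3 \<le> card S"
    and X: "X \<subseteq> UNIV \<times> {c, d}"
    and Y: "\<And>g x y. g \<in> S - {c, d} \<Longrightarrow> {(x, g), (y, g)} \<notin> Y"
    and rev: "\<And>x. x \<in> S - {c, d} \<Longrightarrow> {(x, c), (c, x)} \<notin> Y"
    and d: "edge_triangle_cover (arc_edges S - Y) ((\<lambda>x. (x, d)) ` {x \<in> S - {d}. (x, d) \<notin> X})"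
  shows "edge_triangle_cover (arc_edges S - Y) (arcs S - X)"
proof -
  let ?E = "arc_edges S - Y"
  let ?R = "{x \<in> S - {c}. (x, c) \<notin> X}"
  \<comment> \<open>\<open>U\<close> holds the tails of the arcs that stay inside the clique of
    \<open>c\<close>: none if \<open>(d, c)\<close> is deleted, otherwise \<open>d\<close> and
    \<open>w\<close>.\<close>
  obtain U where U: "d \<notin> ?R - U" "edge_triangle_cover ?E ((\<lambda>x. (x, c)) ` (?R \<inter> U))"
  proof (cases "(d, c) \<in> X")
    case True
    show thesis by (rule that[of "{}"]) (use True in \<open>auto intro: edge_triangle_cover.empty\<close>)
  next
    case False
    let ?Yc = "{e \<in> Y. e \<subseteq> UNIV \<times> {c}}"
    \<comment> \<open>There are \<open>card S - 2\<close> candidates, and each fault inside the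
      clique, at most \<open>card S - 3\<close> in number, rules out at most one.\<close>
    have "\<exists>w\<in>S - {c, d}. (w, c) \<notin> X \<and> {(d, c), (w, c)} \<notin> Y"
    proof (rule ccontr)
      assume neg: "\<not> ?thesis"
      let ?A = "{w \<in> S - {c, d}. (w, c) \<in> X}" and ?B = "{w \<in> S - {c, d}. {(d, c), (w, c)} \<in> Y}"
      have "card (S - {c, d}) \<le> card (?A \<union> ?B)"
        using neg S by (intro card_mono) auto
      also have "\<dots> \<le> card ?A + card ?B" by (rule card_Un_le)
      also have "card ?A \<le> card (X \<inter> UNIV \<times> {c})"
        by (rule card_inj_on_le[of "\<lambda>w. (w, c)"]) (use fin in \<open>auto simp: inj_on_def\<close>)
      also have "card ?B \<le> card ?Yc"
        by (rule card_inj_on_le[of "\<lambda>w. {(d, c), (w, c)}"])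
          (use fin in \<open>auto simp: inj_on_def doubleton_eq_iff\<close>)
      finally show False using c cd S by (simp add: card_Diff_subset)
    qed
    then obtain w where w: "w \<in> S - {c, d}" "(w, c) \<notin> X" "{(d, c), (w, c)} \<notin> Y" by blast
    have "?R \<inter> {d, w} = {d, w}" using w False cd by auto
    moreover have "edge_triangle_cover ?E {(d, c), (w, c)}"
      using w cd by (intro edge_triangle_cover_pair) (auto intro: same_head_arc_edge)
    ultimately show thesis by (intro that[of "{d, w}"]) auto
  qed
  show ?thesis
  proof (rule arc_cover[OF S(1) cd(1), of "?R - U"])
    have R: "x \<in> S - {c, d}" if "x \<in> ?R - U" for x using that U(1) by auto
    show "(x, c) \<notin> X \<and> (c, x) \<notin> X \<and> {(x, c), (c, x)} \<notin> Y" if "x \<in> ?R - U" for x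
      using that R[OF that] rev X by auto
    have "{x \<in> S - {c} - (?R - U). (x, c) \<notin> X} = ?R \<inter> U" by auto
    then show "edge_triangle_cover ?E ((\<lambda>x. (x, c)) ` {x \<in> S - {c} - (?R - U). (x, c) \<notin> X})"
      using U(2) by (simp only:)
    fix g assume g: "g \<in> S - {c}"
    let ?G = "{x \<in> S - {g}. (x, g) \<notin> X \<and> \<not> (g \<in> ?R - U \<and> x = c)}"
    show "edge_triangle_cover ?E ((\<lambda>x. (x, g)) ` ?G)"
    proof (cases "g = d")
      case True
      then have "?G = {x \<in> S - {d}. (x, d) \<notin> X}" using U(1) by blast
      then show ?thesis using d True by (simp only:)
    next
      case False
      show ?thesis
      proof (rule arc_cover_same_head[OF S(1)])
        have "S - {g, c} \<subseteq> ?G" using X False g by auto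
        then have "card (S - {g, c}) \<le> card ?G" using S(1) by (intro card_mono) auto
        moreover have "card (S - {g, c}) = card S - 2"
          using g cd S(1) by (simp add: card_Diff_subset)
        ultimately show "2 \<le> card ?G" using S(2) by simp
      qed (use g False Y in auto)
    qed
  qed auto
qed

text \<open>The detour for four symbols: now the clique of \<open>d\<close> is the one matched
  outwards. An endpoint \<open>(g, d)\<close> of the missing edge goes to its reversal
  \<open>(d, g)\<close>, so the rest of that clique is complete. As \<open>g\<close> differs from
  \<open>c\<close>, no other clique loses more than one vertex.\<close>

lemma arc_cover_one_vertex_one_edge:
  assumes S: "finite S" "4 \<le> card S" and c: "c \<in> S" "d \<in> S" "c \<noteq> d"
    and X: "X \<subseteq> UNIV \<times> {c}" "card X = 1"
    and pq: "p \<in> S" "q \<in> S" "p \<noteq> q" "p \<noteq> d" "q \<noteq> d"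
  shows "edge_triangle_cover (arc_edges S - {{(p, d), (q, d)}}) (arcs S - X)"
proof -
  obtain g where g: "g \<in> {p, q}" "g \<noteq> c" using pq by blast
  then have gS: "g \<in> S - {d}" using pq by auto
  obtain x where x: "X = {(x, c)}" using X by (auto simp: card_1_singleton_iff)
  have card2: "card (S - {u, v}) \<ge> 2" for u v
  proof -
    have "card {u, v} \<le> 2" by (simp add: card_insert_if)
    then show ?thesis using diff_card_le_card_Diff[of "{u, v}" S] S(2) by simp
  qed
  show ?thesis
  proof (rule arc_cover[OF S(1) c(2), of "{g}"])
    show "(y, d) \<notin> X \<and> (d, y) \<notin> X \<and> {(y, d), (d, y)} \<notin> {{(p, d), (q, d)}}" if "y \<in> {g}" for y
      using that g c pq x by (auto simp: doubleton_eq_iff)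
    let ?D = "{y \<in> S - {d} - {g}. (y, d) \<notin> X}"
    have D: "?D = S - {d, g}" using x c by auto
    show "edge_triangle_cover (arc_edges S - {{(p, d), (q, d)}}) ((\<lambda>y. (y, d)) ` ?D)"
    proof (rule arc_cover_same_head[OF S(1) c(2)])
      show "2 \<le> card ?D" unfolding D by (rule card2)
      show "{(u, d), (v, d)} \<notin> {{(p, d), (q, d)}}" if "u \<in> ?D" "v \<in> ?D" for u v
        using that g(1) by (auto simp: doubleton_eq_iff)
    qed auto
    fix h assume h: "h \<in> S - {d}"
    let ?H = "{y \<in> S - {h}. (y, h) \<notin> X \<and> \<not> (h \<in> {g} \<and> y = d)}"
    show "edge_triangle_cover (arc_edges S - {{(p, d), (q, d)}}) ((\<lambda>y. (y, h)) ` ?H)"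
    proof (rule arc_cover_same_head[OF S(1)])
      \<comment> \<open>The clique of \<open>c\<close> misses the deleted vertex, the clique of
        \<open>g\<close> the arc from \<open>d\<close>.\<close>
      have "S - {h, if h = c then x else d} \<subseteq> ?H" using x g by auto
      then have "card (S - {h, if h = c then x else d}) \<le> card ?H" using S(1) by (intro card_mono) auto
      then show "2 \<le> card ?H" using card2 order_trans by blast
      show "{(u, h), (v, h)} \<notin> {{(p, d), (q, d)}}" for u v
        using h by (auto simp: doubleton_eq_iff)
    qed (use h in auto)
  qed (use gS in auto)
qed

text \<open>\<open>?f d\<close> counts the faults inside the clique of head \<open>d\<close>, which
  has \<open>card S - 1\<close> vertices. It is covered on its own if \<open>?f d\<close> is at most
  \<open>card S - 4\<close>. A clique with more faults leaves at most one fault elsewhere, and the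
  proof splits on the kind of that fault.\<close>

lemma arc_cover_few_faults:
  fixes S :: "'a::linorder set"
  assumes S: "finite S" "4 \<le> card S" and X: "X \<subseteq> arcs S" and Y: "Y \<subseteq> arc_edges S"
    and few: "card X + card Y + 2 \<le> card S"
  shows "edge_triangle_cover (arc_edges S - Y) (arcs S - X)"
proof -
  have fin: "finite X" "finite Y"
    using X Y S(1) finite_arcs finite_arc_edges finite_subset by metis+
  let ?H = "\<lambda>d. UNIV \<times> {d} :: ('a \<times> 'a) set"
  let ?f = "\<lambda>d. card (X \<inter> ?H d) + card {e \<in> Y. e \<subseteq> ?H d}"
  have "card S \<le> ?f d + 3" if "\<not> ?f d + 4 \<le> card S" for d using that by linarith
  \<comment> \<open>The intact reversal matching is split off first so that, with four symbols, case
    \<open>heavy\<close> can exclude an empty \<open>X\<close> when the outside fault is an edge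
    with a common head.\<close>
  then consider (rev) "X = {}" "\<forall>x\<in>S. \<forall>y\<in>S. x \<noteq> y \<longrightarrow> {(x, y), (y, x)} \<notin> Y"
    | (spread) "\<forall>d\<in>S. ?f d + 4 \<le> card S"
    | (heavy) c where "c \<in> S" "card S \<le> ?f c + 3"
      "\<not> (X = {} \<and> (\<forall>x\<in>S. \<forall>y\<in>S. x \<noteq> y \<longrightarrow> {(x, y), (y, x)} \<notin> Y))"
    by meson
  then show ?thesis
  proof cases
    case rev
    then show ?thesis using arc_cover_reversals[OF S(1), of Y] by simp
  next
    case spread
    have near: "edge_triangle_cover (arc_edges S - Y) ((\<lambda>x. (x, d)) ` {x \<in> S - {d}. (x, d) \<notin> X})"
      if d: "d \<in> S" for d
    proof (rule arc_cover_near_same_head[OF S(1) d _ fin(2)])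
      have "card (fst ` (X \<inter> ?H d)) \<le> card (X \<inter> ?H d)" using fin by (intro card_image_le) auto
      moreover have "card (S - {d} - fst ` (X \<inter> ?H d)) \<ge> card (S - {d}) - card (fst ` (X \<inter> ?H d))"
        using fin by (intro diff_card_le_card_Diff) auto
      moreover have "fst ` (X \<inter> ?H d) = {x. (x, d) \<in> X}" by force
      then have "S - {d} - fst ` (X \<inter> ?H d) = {x \<in> S - {d}. (x, d) \<notin> X}" by auto
      ultimately show "card {e \<in> Y. e \<subseteq> ?H d} + 3 \<le> card {x \<in> S - {d}. (x, d) \<notin> X}"
        using spread[rule_format, OF d] d S by simp
    qed auto
    obtain c where c: "c \<in> S" using S by fastforce
    show ?thesis
      by (rule arc_cover[OF S(1) c, of "{}"]) (use near[OF c] near in simp_all)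
  next
    case heavy
    let ?X = "X - ?H c" and ?Y = "{e \<in> Y. \<not> e \<subseteq> ?H c}"
    have cX: "card X = card (X \<inter> ?H c) + card ?X"
      using card_Int_Diff[OF fin(1)] by simp
    have cY: "card Y = card {e \<in> Y. e \<subseteq> ?H c} + card ?Y"
      using fin by (subst card_Un_disjoint[symmetric]) (auto intro!: arg_cong[where f = card])
    have le1: "card ?X + card ?Y \<le> 1" using few heavy cX cY by simp
    then consider (none) "card ?X = 0" "card ?Y = 0" | (vertex) "card ?X = 1" "card ?Y = 0"
      | (edge) "card ?X = 0" "card ?Y = 1" by linarith
    then show ?thesis
    proof cases
      case none
      then have "?X = {}" "?Y = {}" using fin by auto
      then show ?thesis using X by (intro arc_cover_one_head[OF S, of X c Y]) auto
    next
      case vertex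
      from vertex(1) obtain p where "?X = {p}" by (rule card_1_singletonE)
      then obtain x d where v: "?X = {(x, d)}" by (cases p) simp
      have Y0: "e \<subseteq> ?H c" if "e \<in> Y" for e using vertex fin that by auto
      have d: "d \<in> S" "c \<noteq> d" using v X by (auto simp: arcs_def)
      show ?thesis
      proof (rule arc_cover_two_heads[OF S heavy(1) d fin])
        show "?f c + 3 \<le> card S" using few cX cY vertex by simp
        have "X \<subseteq> ?H c \<union> {(x, d)}" using v by (simp only: Diff_subset_conv[symmetric] order_refl)
        then show "X \<subseteq> UNIV \<times> {c, d}" by auto
        show "{(x, g), (y, g)} \<notin> Y" if "g \<in> S - {c, d}" for g x y
          using Y0[of "{(x, g), (y, g)}"] that by auto
        show "{(x, c), (c, x)} \<notin> Y" if "x \<in> S - {c, d}" for x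
          using Y0[of "{(x, c), (c, x)}"] that by auto
        show "edge_triangle_cover (arc_edges S - Y) ((\<lambda>x. (x, d)) ` {x \<in> S - {d}. (x, d) \<notin> X})"
        proof (rule arc_cover_same_head[OF S(1) d(1)])
          have "S - {d, x} \<subseteq> {x \<in> S - {d}. (x, d) \<notin> X}" using v d by auto
          then have "card (S - {d, x}) \<le> card {x \<in> S - {d}. (x, d) \<notin> X}"
            using S by (intro card_mono) auto
          moreover have "card {d, x} \<le> 2" by (simp add: card_insert_if)
          then have "2 \<le> card (S - {d, x})"
            using diff_card_le_card_Diff[of "{d, x}" S] S(2) by simp
          ultimately show "2 \<le> card {x \<in> S - {d}. (x, d) \<notin> X}" by simp
          show "{(x, d), (y, d)} \<notin> Y" for x y
            using Y0[of "{(x, d), (y, d)}"] d by auto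
        qed auto
      qed
    next
      case edge
      from edge(2) obtain e where e: "?Y = {e}" by (rule card_1_singletonE)
      have Y0: "e' \<subseteq> ?H c \<or> e' = e" if "e' \<in> Y" for e' using e that by auto
      have eY: "e \<in> Y" "\<not> e \<subseteq> ?H c" using e by auto
      have X0: "X \<subseteq> ?H c" using edge fin by auto
      have fc: "?f c + 3 \<le> card S" using few cX cY edge by simp
      have full: "card {x \<in> S - {d}. (x, d) \<notin> X} = card S - 1" if "d \<in> S" "d \<noteq> c" for d
      proof -
        have "{x \<in> S - {d}. (x, d) \<notin> X} = S - {d}" using that X0 by auto
        then show ?thesis using that S(1) by simp
      qed
      have "e \<in> arc_edges S" using eY Y by auto
      then show ?thesis
      proof (cases rule: arc_edges_cases)
        case (reversal p q)
        \<comment> \<open>An endpoint of the faulty reversal edge other than \<open>c\<close>. If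
          that edge is \<open>{(d, c), (c, d)}\<close>, the construction avoids it, since
          \<open>(d, c)\<close> is not matched outwards.\<close>
        define d where "d = (if p = c then q else p)"
        have d: "d \<in> S" "c \<noteq> d" using reversal unfolding d_def by auto
        show ?thesis
        proof (rule arc_cover_two_heads[OF S heavy(1) d fin fc])
          show "X \<subseteq> UNIV \<times> {c, d}" using X0 by blast
          show "{(x, g), (y, g)} \<notin> Y" if "g \<in> S - {c, d}" for g x y
            using Y0[of "{(x, g), (y, g)}"] that reversal by (auto simp: doubleton_eq_iff)
          show "{(x, c), (c, x)} \<notin> Y" if "x \<in> S - {c, d}" for x
            using Y0[of "{(x, c), (c, x)}"] that reversal
            by (auto simp: doubleton_eq_iff d_def split: if_splits)
          show "edge_triangle_cover (arc_edges S - Y) ((\<lambda>x. (x, d)) ` {x \<in> S - {d}. (x, d) \<notin> X})"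
          proof (rule arc_cover_same_head[OF S(1) d(1)])
            show "2 \<le> card {x \<in> S - {d}. (x, d) \<notin> X}" using full d S(2) by simp
            show "{(x, d), (y, d)} \<notin> Y" for x y
              using Y0[of "{(x, d), (y, d)}"] d reversal by (auto simp: doubleton_eq_iff)
          qed auto
        qed
      next
        case (same_head p q d)
        then have d: "d \<in> S" "c \<noteq> d" using eY by auto
        show ?thesis
        proof (cases "card S = 4")
          case True
          \<comment> \<open>The arcs with head \<open>d\<close> form a triangle without one edge, which has no cover of its own.\<close>
          have "X \<noteq> {}"
          proof
            assume "X = {}"
            then obtain x y where "x \<noteq> y" "{(x, y), (y, x)} \<in> Y" using heavy(3) by blast
            then show False
              using Y0[of "{(x, y), (y, x)}"] same_head by (auto simp: doubleton_eq_iff)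
          qed
          then have "card X \<ge> 1" using fin by (simp add: Suc_leI card_gt_0_iff)
          moreover have "card Y \<ge> 1" using cY edge by simp
          ultimately have "card X = 1" "card Y = 1" using few True by auto
          moreover from this have "Y = {e}" using eY(1) by (metis card_1_singletonE singletonD)
          ultimately show ?thesis
            using arc_cover_one_vertex_one_edge[OF S heavy(1) d X0] same_head by simp
        next
          \<comment> \<open>With at least five symbols the clique of \<open>d\<close> has four or
            more vertices and tolerates its one missing edge.\<close>
          case False
          show ?thesis
          proof (rule arc_cover_two_heads[OF S heavy(1) d fin fc])
            show "X \<subseteq> UNIV \<times> {c, d}" using X0 by blast
            show "{(x, g), (y, g)} \<notin> Y" if "g \<in> S - {c, d}" for g x y
              using Y0[of "{(x, g), (y, g)}"] that same_head by (auto simp: doubleton_eq_iff)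
            show "{(x, c), (c, x)} \<notin> Y" if "x \<in> S - {c, d}" for x
              using Y0[of "{(x, c), (c, x)}"] that same_head by (auto simp: doubleton_eq_iff)
            show "edge_triangle_cover (arc_edges S - Y) ((\<lambda>x. (x, d)) ` {x \<in> S - {d}. (x, d) \<notin> X})"
            proof (rule arc_cover_near_same_head[OF S(1) d(1) _ fin(2)])
              have "e' = e" if "e' \<in> Y" "e' \<subseteq> ?H d" for e'
              proof (rule ccontr)
                assume "e' \<noteq> e"
                then have "e' \<subseteq> ?H c" using Y0 that by blast
                then have "e' = {}" using that d by auto
                then show False using that(1) Y by (auto simp: arc_edges_def)
              qed
              then have "{e' \<in> Y. e' \<subseteq> ?H d} \<subseteq> {e}" by auto
              then have "card {e' \<in> Y. e' \<subseteq> ?H d} \<le> 1" using card_mono[of "{e}"] by fastforce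
              then show "card {e' \<in> Y. e' \<subseteq> ?H d} + 3 \<le> card {x \<in> S - {d}. (x, d) \<notin> X}"
                using full[of d] d False S(2) by simp
            qed auto
          qed
        qed
      qed
    qed
  qed
qed

subsection \<open>Blocks of the star graph\<close>

text \<open>For \<open>J\<close> inside \<open>{1..<k}\<close> a nonempty block is a copy of the
  star graph with \<open>n - card J\<close> symbols and \<open>k - card J\<close> positions. Index 0
  is always left free.\<close>

definition block :: "nat \<Rightarrow> nat \<Rightarrow> nat set \<Rightarrow> (nat \<Rightarrow> nat) \<Rightarrow> nat list set" where
  "block n k J \<phi> = {a \<in> nk_star_verts n k. \<forall>j\<in>J. a ! j = \<phi> j}"

lemma block_empty: "block n k {} \<phi> = nk_star_verts n k"
  by (simp add: block_def)

lemma finite_nk_star_verts: "finite (nk_star_verts n k)"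
  by (rule finite_subset[of _ "{a. set a \<subseteq> {1..n} \<and> length a = k}"])
    (auto simp: nk_star_verts_def intro: finite_lists_length_eq[of "{1..n}", simplified])

lemma finite_block: "finite (block n k J \<phi>)"
  by (rule finite_subset[OF _ finite_nk_star_verts[of n k]]) (auto simp: block_def)

lemma nk_star_edges_subset:
  "e \<in> edges (nk_star_graph n k) \<Longrightarrow> e \<subseteq> nk_star_verts n k"
  by (auto simp: nk_star_graph_def)

lemma finite_nk_star_edges: "finite (edges (nk_star_graph n k))"
  by (rule finite_subset[of _ "Pow (nk_star_verts n k)"])
    (use nk_star_edges_subset finite_nk_star_verts in auto)

lemma nk_star_edgeI:
  "a \<in> nk_star_verts n k \<Longrightarrow> b \<in> nk_star_verts n k \<Longrightarrow> nk_star_adj k a b \<Longrightarrow>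
    {a, b} \<in> edges (nk_star_graph n k)"
  unfolding nk_star_graph_def by auto

lemma nk_star_edgeE:
  assumes "e \<in> edges (nk_star_graph n k)"
  obtains a b where "e = {a, b}" "a \<in> nk_star_verts n k" "b \<in> nk_star_verts n k" "nk_star_adj k a b"
  using assms unfolding nk_star_graph_def by auto

lemma verts_nk_star_graph [simp]: "verts (nk_star_graph n k) = nk_star_verts n k"
  by (simp add: nk_star_graph_def)

text \<open>A block with one free position besides the first is a copy of the arc graph: the free
  symbols sit at the first position (tail) and at the free position \<open>j\<close> (head).\<close>

lemma block_arcs:
  assumes k: "2 \<le> k" and j: "j \<in> {1..<k}"
    and t: "t \<in> block n k ({1..<k} - {j}) \<phi>"
  defines "S \<equiv> {1..n} - (!) t ` ({1..<k} - {j})"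
    and "v \<equiv> \<lambda>(x, c). t[0 := x, j := c]"
  shows "card S + k = n + 2"
    and "v ` arcs S = block n k ({1..<k} - {j}) \<phi>"
    and "inj_on v (arcs S)"
    and "e \<in> arc_edges S \<Longrightarrow> v ` e \<in> edges (nk_star_graph n k)"
    and "v (x, c) ! j = c"
proof -
  have len: "length t = k" and dist: "distinct t" and sub: "set t \<subseteq> {1..n}"
    using t by (auto simp: block_def nk_star_verts_def)
  have nth: "v (x, c) ! i = (if i = j then c else if i = 0 then x else t ! i)" if "i < k" for x c i
    using that j len by (auto simp: v_def nth_list_update)
  have lenv: "length (v p) = k" for p using len by (cases p) (simp add: v_def)
  show "v (x, c) ! j = c" for x c using nth j by simp
  have ran: "t ! i \<in> {1..n}" if "i < k" for i using sub len that by (metis nth_mem subsetD)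
  have "inj_on ((!) t) ({1..<k} - {j})" using dist len by (auto intro!: inj_on_nth)
  then have "card ((!) t ` ({1..<k} - {j})) = k - 2" using j by (simp add: card_image)
  moreover have "(!) t ` ({1..<k} - {j}) \<subseteq> {1..n}" using ran by auto
  ultimately have "card S = n - (k - 2)" unfolding S_def by (subst card_Diff_subset) auto
  moreover have "k \<le> n" using card_mono[OF _ sub] distinct_card[OF dist] len by simp
  ultimately show "card S + k = n + 2" using k by simp
  have S_nth: "t ! i \<noteq> x" if "x \<in> S" "i < k" "i \<noteq> 0" "i \<noteq> j" for x i
    using that unfolding S_def by auto
  have vV: "v p \<in> block n k ({1..<k} - {j}) \<phi>" if p: "p \<in> arcs S" for p
  proof -
    obtain x c where p_eq: "p = (x, c)" by fastforce
    have xc: "x \<in> S" "c \<in> S" "x \<noteq> c" using p unfolding p_eq arcs_def by auto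
    have "distinct (v p)"
      unfolding distinct_conv_nth lenv
    proof (intro allI impI)
      fix i i' assume i: "i < k" "i' < k" "i \<noteq> i'"
      have "t ! i \<noteq> t ! i'" using dist i len by (simp add: nth_eq_iff_index_eq)
      then show "v p ! i \<noteq> v p ! i'"
        unfolding p_eq nth[OF i(1)] nth[OF i(2)] using i j xc S_nth[of _ i] S_nth[of _ i'] by auto
    qed
    moreover have "set (v p) \<subseteq> {1..n}"
    proof
      fix y assume "y \<in> set (v p)"
      then obtain i where "i < k" "y = v p ! i" unfolding in_set_conv_nth lenv by blast
      then show "y \<in> {1..n}" using ran[of i] xc unfolding p_eq by (auto simp: nth S_def)
    qed
    moreover have "v p ! i = \<phi> i" if "i \<in> {1..<k} - {j}" for i
      using that t unfolding p_eq by (auto simp: nth block_def)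
    ultimately show ?thesis by (simp add: block_def nk_star_verts_def lenv)
  qed
  show "v ` arcs S = block n k ({1..<k} - {j}) \<phi>"
  proof
    show "block n k ({1..<k} - {j}) \<phi> \<subseteq> v ` arcs S"
    proof
      fix a assume a: "a \<in> block n k ({1..<k} - {j}) \<phi>"
      have a': "length a = k" "distinct a" "set a \<subseteq> {1..n}" "\<And>i. i \<in> {1..<k} - {j} \<Longrightarrow> a ! i = t ! i"
        using a t by (auto simp: block_def nk_star_verts_def)
      \<comment> \<open>As \<open>a\<close> is distinct, its two free entries avoid the symbols at
        the fixed positions, which it shares with \<open>t\<close>.\<close>
      have aS: "a ! i \<in> S" if "i = 0 \<or> i = j" for i
      proof -
        have "a ! i \<noteq> t ! i'" if "i' \<in> {1..<k} - {j}" for i'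
        proof -
          have "i < k" "i' < k" "i \<noteq> i'" using that \<open>i = 0 \<or> i = j\<close> k j by auto
          then have "a ! i \<noteq> a ! i'" using a'(1,2) by (simp add: nth_eq_iff_index_eq)
          then show ?thesis using a'(4)[OF that] by simp
        qed
        moreover have "i < length a" using a'(1) that k j by auto
        then have "a ! i \<in> {1..n}" using a'(3) nth_mem by blast
        ultimately show ?thesis unfolding S_def by blast
      qed
      have "a ! 0 \<noteq> a ! j" using a' j k by (simp add: nth_eq_iff_index_eq)
      then have "(a ! 0, a ! j) \<in> arcs S" using aS by (simp add: arcs_def)
      moreover have "a = v (a ! 0, a ! j)"
        using a' by (intro nth_equalityI) (auto simp: lenv nth)
      ultimately show "a \<in> v ` arcs S" by blast
    qed
  qed (use vV in auto)
  show "inj_on v (arcs S)"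
  proof (rule inj_onI)
    fix p q assume "v p = v q"
    moreover have "fst r = v r ! 0 \<and> snd r = v r ! j" for r
      using j k by (cases r) (simp add: nth)
    ultimately show "p = q" by (metis prod_eq_iff)
  qed
  show "v ` e \<in> edges (nk_star_graph n k)" if e: "e \<in> arc_edges S"
  proof -
    have V: "v p \<in> nk_star_verts n k" if "p \<in> e" for p
      using vV[of p] arc_edges_subset[OF e] that by (auto simp: block_def)
    show ?thesis
      using e
    proof (cases rule: arc_edges_cases)
      case (same_head x y c)
      have "nk_star_adj k (v (x, c)) (v (y, c))"
        unfolding nk_star_adj_def using same_head j k by (intro disjI2) (auto simp: nth)
      then show ?thesis using V same_head(1) by (auto intro!: nk_star_edgeI)
    next
      case (reversal x y)
      have "v (y, x) = (v (x, y))[0 := v (x, y) ! j, j := v (x, y) ! 0]"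
        using j k by (intro nth_equalityI) (auto simp: lenv nth nth_list_update)
      then have "nk_star_adj k (v (x, y)) (v (y, x))"
        unfolding nk_star_adj_def using j by blast
      then show ?thesis using V reversal(1) by (auto intro!: nk_star_edgeI)
    qed
  qed
qed

text \<open>The budget of the smaller star graph: the block has \<open>n - card J\<close> free
  symbols and may contain at most two fewer faults.\<close>

definition few_faults :: "nat \<Rightarrow> nat \<Rightarrow> nat list set \<Rightarrow> nat list set set \<Rightarrow> nat set \<Rightarrow> (nat \<Rightarrow> nat) \<Rightarrow> bool" where
  "few_faults n k X Y J \<phi> \<longleftrightarrow>
     card (X \<inter> block n k J \<phi>) + card {e \<in> Y. e \<subseteq> block n k J \<phi>} + card J + 2 \<le> n"

text \<open>Fixing all positions but the first leaves a clique of mutually adjacent vertices.\<close>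

definition faults_in_clique
  :: "nat \<Rightarrow> nat \<Rightarrow> nat list set \<Rightarrow> nat list set set \<Rightarrow> nat set \<Rightarrow> (nat \<Rightarrow> nat) \<Rightarrow> bool" where
  "faults_in_clique n k X Y J \<phi> \<longleftrightarrow> (\<exists>\<psi>. X \<inter> block n k J \<phi> \<subseteq> block n k {1..<k} \<psi> \<and>
     (\<forall>e\<in>Y. e \<subseteq> block n k J \<phi> \<longrightarrow> e \<subseteq> block n k {1..<k} \<psi>))"

text \<open>The faults are pulled back along \<open>v\<close> to the arc graph, which has
  \<open>n + 2 - k\<close>, hence at least four, symbols. Injectivity of \<open>v\<close> keeps
  their number from growing, and a faulty clique becomes a set of arcs with one common head.\<close>

lemma block_cover_base:
  assumes k: "2 \<le> k" "k + 2 \<le> n" and j: "j \<in> {1..<k}" and J: "J = {1..<k} - {j}"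
    and Y: "Y \<subseteq> edges (nk_star_graph n k)"
    and faults: "few_faults n k X Y J \<phi> \<or> faults_in_clique n k X Y J \<phi>"
  shows "edge_triangle_cover (edges (nk_star_graph n k) - Y) (block n k J \<phi> - X)"
proof (cases "block n k J \<phi> = {}")
  case True
  then show ?thesis by (simp add: edge_triangle_cover.empty)
next
  case False
  then obtain t where t: "t \<in> block n k ({1..<k} - {j}) \<phi>" using J by auto
  define S where "S = {1..n} - (!) t ` ({1..<k} - {j})"
  define v where "v = (\<lambda>(x, c). t[0 := x, j := c])"
  note v = block_arcs[OF k(1) j t, folded S_def v_def]
  have S: "finite S" "4 \<le> card S" using v(1) k by (simp_all add: S_def)
  let ?B = "block n k J \<phi>"
  have vB: "v ` arcs S = ?B" using v(2) J by simp
  let ?X = "{p \<in> arcs S. v p \<in> X}" and ?Y = "{e \<in> arc_edges S. v ` e \<in> Y}"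
  have "edge_triangle_cover (arc_edges S - ?Y) (arcs S - ?X)"
    using faults
  proof
    assume few: "few_faults n k X Y J \<phi>"
    show ?thesis
    proof (rule arc_cover_few_faults[OF S])
      have "card ?X \<le> card (X \<inter> ?B)"
        by (rule card_inj_on_le[of v])
          (use v(3) vB finite_block in \<open>auto intro: inj_on_subset\<close>)
      moreover have "card ?Y \<le> card {e \<in> Y. e \<subseteq> ?B}"
      proof (rule card_inj_on_le[of "(`) v"])
        show "inj_on ((`) v) ?Y"
          using inj_on_image_Pow[OF v(3)] by (rule inj_on_subset) (use arc_edges_subset in auto)
        show "(`) v ` ?Y \<subseteq> {e \<in> Y. e \<subseteq> ?B}"
          unfolding vB[symmetric] using arc_edges_subset by blast
        show "finite {e \<in> Y. e \<subseteq> ?B}"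
          using Y finite_nk_star_edges finite_subset by fastforce
      qed
      \<comment> \<open>Thus the budget \<open>n - card J - 2\<close> of the block equals
        \<open>card S - 2\<close>.\<close>
      moreover have "card J = k - 2" using J j by simp
      ultimately show "card ?X + card ?Y + 2 \<le> card S"
        using few v(1) k unfolding few_faults_def by linarith
    qed auto
  next
    assume "faults_in_clique n k X Y J \<phi>"
    then obtain \<psi> where \<psi>: "X \<inter> ?B \<subseteq> block n k {1..<k} \<psi>"
      "\<forall>e\<in>Y. e \<subseteq> ?B \<longrightarrow> e \<subseteq> block n k {1..<k} \<psi>"
      unfolding faults_in_clique_def by (elim exE conjE)
    have head: "snd p = \<psi> j" if "v p \<in> block n k {1..<k} \<psi>" for p
      using that j v(5)[of "fst p" "snd p"] by (simp add: block_def)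
    show ?thesis
    proof (rule arc_cover_one_head[OF S, where c = "\<psi> j"])
      show "?X \<subseteq> arcs S \<inter> UNIV \<times> {\<psi> j}"
      proof
        fix p assume p: "p \<in> ?X"
        then have "v p \<in> ?B" using vB by auto
        then have "snd p = \<psi> j" using p \<psi>(1) head by blast
        then show "p \<in> arcs S \<inter> UNIV \<times> {\<psi> j}" using p by (cases p) auto
      qed
      show "e \<subseteq> UNIV \<times> {\<psi> j}" if "e \<in> ?Y" for e
      proof -
        have "v ` e \<subseteq> ?B" using that arc_edges_subset[of e S] vB by auto
        then have "v ` e \<subseteq> block n k {1..<k} \<psi>" using that \<psi>(2) by blast
        then have "snd p = \<psi> j" if "p \<in> e" for p using head that by blast
        then show ?thesis by (metis SigmaI UNIV_I prod.collapse singletonI subsetI)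
      qed
    qed
  qed
  then have "edge_triangle_cover (edges (nk_star_graph n k) - Y) (v ` (arcs S - ?X))"
    by (rule edge_triangle_cover_image) (use v(3,4) in \<open>auto intro: inj_on_subset\<close>)
  moreover have "v ` (arcs S - ?X) = ?B - X" unfolding vB[symmetric] by auto
  ultimately show ?thesis by simp
qed

lemma block_insert:
  "j \<notin> J \<Longrightarrow> block n k (insert j J) (\<phi>(j := c)) = {a \<in> block n k J \<phi>. a ! j = c}"
  by (auto simp: block_def)

text \<open>The disjunction is the invariant of the induction: fixing a position lowers the budget
  by one, so \<open>few_faults\<close> may fail for a sub-block, whereas
  \<open>faults_in_clique\<close> passes to all sub-blocks. The bound on \<open>card J\<close> keeps
  a free position besides the first.\<close>

lemma block_cover:
  assumes k: "2 \<le> k" "k + 2 \<le> n" and Y: "Y \<subseteq> edges (nk_star_graph n k)"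
    and "J \<subseteq> {1..<k}" "card J + 2 \<le> k"
    and "few_faults n k X Y J \<phi> \<or> faults_in_clique n k X Y J \<phi>"
  shows "edge_triangle_cover (edges (nk_star_graph n k) - Y) (block n k J \<phi> - X)"
  using assms(4-)
proof (induction "k - card J" arbitrary: J \<phi> rule: less_induct)
  case less
  let ?B = "block n k J \<phi>"
  let ?sub = "\<lambda>j c. block n k (insert j J) (\<phi>(j := c))"
  have finJ: "finite J" using less.prems(1) finite_subset by blast
  have cfree: "card ({1..<k} - J) = k - 1 - card J"
    using less.prems(1) finJ by (simp add: card_Diff_subset)
  show ?case
  proof (cases "card J + 2 = k")
    case True
    then have "card ({1..<k} - J) = 1" using cfree by simp
    then obtain j where "{1..<k} - J = {j}" by (auto simp: card_1_singleton_iff)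
    then have "j \<in> {1..<k}" "J = {1..<k} - {j}" using less.prems(1) by auto
    then show ?thesis using block_cover_base[OF k _ _ Y] less.prems(3) by blast
  next
    case False
    then have free: "card ({1..<k} - J) \<ge> 2" using cfree less.prems(2) by simp
    \<comment> \<open>One position whose sub-blocks all satisfy the invariant suffices, since they
      partition the block.\<close>
    have "\<exists>j\<in>{1..<k} - J. \<forall>c\<in>{1..n}.
      few_faults n k X Y (insert j J) (\<phi>(j := c)) \<or> faults_in_clique n k X Y (insert j J) (\<phi>(j := c))"
    proof (cases "\<exists>j\<in>{1..<k} - J. \<forall>c\<in>{1..n}. few_faults n k X Y (insert j J) (\<phi>(j := c))")
      case True
      then show ?thesis by blast
    next
      case spread: False
      have "faults_in_clique n k X Y J \<phi>"
      proof (rule ccontr)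
        assume "\<not> ?thesis"
        then have few: "few_faults n k X Y J \<phi>" using less.prems(3) by blast
        obtain d where d: "\<And>j. j \<in> {1..<k} - J \<Longrightarrow> \<not> few_faults n k X Y (insert j J) (\<phi>(j := d j))"
          using spread by metis
        \<comment> \<open>The clique that will contain all faults: \<open>\<phi>\<close> at the
          fixed positions, and the symbol of an overfull sub-block at each free one.\<close>
        define \<psi> where "\<psi> i = (if i \<in> J then \<phi> i else d i)" for i
        have all: "X \<inter> ?B \<subseteq> ?sub j (d j)" "{e \<in> Y. e \<subseteq> ?B} \<subseteq> {e \<in> Y. e \<subseteq> ?sub j (d j)}"
          if j: "j \<in> {1..<k} - J" for j
        proof -
          have fin: "finite (X \<inter> ?B)" "finite {e \<in> Y. e \<subseteq> ?B}"
            using finite_block Y finite_nk_star_edges finite_subset[of Y] by auto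
          have sub: "X \<inter> ?sub j (d j) \<subseteq> X \<inter> ?B" "{e \<in> Y. e \<subseteq> ?sub j (d j)} \<subseteq> {e \<in> Y. e \<subseteq> ?B}"
            using j block_insert[of j J n k \<phi>] by auto
          note le = card_mono[OF fin(1) sub(1)] card_mono[OF fin(2) sub(2)]
          have "card (insert j J) = card J + 1" using j finJ by simp
          \<comment> \<open>The budget of the sub-block is smaller by exactly one, so exceeding it
            takes at least as many faults as the whole block has.\<close>
          then have "card (X \<inter> ?B) + card {e \<in> Y. e \<subseteq> ?B}
              \<le> card (X \<inter> ?sub j (d j)) + card {e \<in> Y. e \<subseteq> ?sub j (d j)}"
            using few d[OF j] unfolding few_faults_def by linarith
          then have "card (X \<inter> ?sub j (d j)) = card (X \<inter> ?B)"
            "card {e \<in> Y. e \<subseteq> ?sub j (d j)} = card {e \<in> Y. e \<subseteq> ?B}"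
            using le by linarith+
          then have "X \<inter> ?sub j (d j) = X \<inter> ?B" "{e \<in> Y. e \<subseteq> ?sub j (d j)} = {e \<in> Y. e \<subseteq> ?B}"
            using card_subset_eq[OF fin(1) sub(1)] card_subset_eq[OF fin(2) sub(2)] by blast+
          then show "X \<inter> ?B \<subseteq> ?sub j (d j)"
            "{e \<in> Y. e \<subseteq> ?B} \<subseteq> {e \<in> Y. e \<subseteq> ?sub j (d j)}" by blast+
        qed
        have clique: "a \<in> block n k {1..<k} \<psi>"
          if a: "a \<in> ?B" "\<And>j. j \<in> {1..<k} - J \<Longrightarrow> a \<in> ?sub j (d j)" for a
        proof -
          have "a ! i = \<psi> i" if i: "i \<in> {1..<k}" for i
            using i a(1) a(2)[of i] by (auto simp: \<psi>_def block_def)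
          then show ?thesis using a(1) by (simp add: block_def)
        qed
        have "X \<inter> ?B \<subseteq> block n k {1..<k} \<psi>"
        proof
          fix a assume a: "a \<in> X \<inter> ?B"
          have "a \<in> ?sub j (d j)" if "j \<in> {1..<k} - J" for j using all(1)[OF that] a by (rule subsetD)
          then show "a \<in> block n k {1..<k} \<psi>" using a by (intro clique) auto
        qed
        moreover have "\<forall>e\<in>Y. e \<subseteq> ?B \<longrightarrow> e \<subseteq> block n k {1..<k} \<psi>"
        proof (intro ballI impI subsetI)
          fix e a assume e: "e \<in> Y" "e \<subseteq> ?B" "a \<in> e"
          have "e \<subseteq> ?sub j (d j)" if "j \<in> {1..<k} - J" for j using all(2)[OF that] e(1,2) by auto
          then show "a \<in> block n k {1..<k} \<psi>" using e(2,3) by (intro clique) auto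
        qed
        ultimately have "faults_in_clique n k X Y J \<phi>"
          unfolding faults_in_clique_def by (intro exI conjI)
        then show False using \<open>\<not> faults_in_clique n k X Y J \<phi>\<close> by contradiction
      qed
      moreover obtain j where j: "j \<in> {1..<k} - J"
        using free by (metis card.empty ex_in_conv not_numeral_le_zero)
      moreover have "?sub j c \<subseteq> ?B" for c using j block_insert[of j J n k \<phi> c] by auto
      ultimately have "faults_in_clique n k X Y (insert j J) (\<phi>(j := c))" for c
        unfolding faults_in_clique_def by (meson Int_mono order_refl order_trans)
      then show ?thesis using j by blast
    qed
    then obtain j where j: "j \<in> {1..<k} - J"
      and sub: "\<And>c. c \<in> {1..n} \<Longrightarrow> few_faults n k X Y (insert j J) (\<phi>(j := c)) \<or>
        faults_in_clique n k X Y (insert j J) (\<phi>(j := c))" by blast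
    have eq: "?sub j c = {a \<in> ?B. a ! j = c}" for c using j by (intro block_insert) auto
    have cJ: "card (insert j J) = card J + 1" using j finJ by simp
    have "edge_triangle_cover (edges (nk_star_graph n k) - Y) (\<Union>c\<in>{1..n}. ?sub j c - X)"
    proof (rule edge_triangle_cover_UN)
      fix c assume "c \<in> {1..n}"
      then show "edge_triangle_cover (edges (nk_star_graph n k) - Y) (?sub j c - X)"
        using sub j cJ False less.prems(1,2) by (intro less.hyps) auto
    qed (auto simp: eq)
    moreover have "a ! j \<in> {1..n}" if "a \<in> ?B" for a
    proof -
      have "j < length a" "set a \<subseteq> {1..n}" using that j by (auto simp: block_def nk_star_verts_def)
      then show ?thesis using nth_mem by blast
    qed
    then have "(\<Union>c\<in>{1..n}. ?sub j c - X) = ?B - X" by (auto simp: eq)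
    ultimately show ?thesis by simp
  qed
qed

section \<open>Lower and upper bounds for the star graph\<close>

lemma nk_star_few_faults:
  assumes k: "2 \<le> k" "k + 2 \<le> n"
    and Y: "Y \<subseteq> edges (nk_star_graph n k)" and few: "finite X" "card X + card Y + 2 \<le> n"
  shows "has_fractional_perfect_matching (delete_elems (nk_star_graph n k) X Y)"
proof -
  let ?E = "edges (nk_star_graph n k)" and ?V = "nk_star_verts n k"
  have finY: "finite Y" using Y finite_nk_star_edges finite_subset by blast
  \<comment> \<open>With no position fixed the block is the whole vertex set, whatever symbol
    function is given.\<close>
  have "few_faults n k X Y {} undefined"
    using few card_mono[OF few(1), of "X \<inter> block n k {} undefined"]
      card_mono[OF finY, of "{e \<in> Y. e \<subseteq> block n k {} undefined}"]
    unfolding few_faults_def by simp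
  then have "edge_triangle_cover (?E - Y) (block n k {} undefined - X)"
    by (intro block_cover[OF k Y]) (use k in auto)
  then have "edge_triangle_cover (?E - Y) (?V - X)" by (simp only: block_empty)
  then obtain g :: "nat list set \<Rightarrow> real" where g: "\<forall>e. 0 \<le> g e \<and> g e \<le> 1"
    "\<forall>e. g e \<noteq> 0 \<longrightarrow> e \<in> ?E - Y \<and> e \<subseteq> ?V - X"
    "\<forall>v\<in>?V - X. (\<Sum>e | e \<in> ?E - Y \<and> v \<in> e. g e) = 1"
    using edge_triangle_cover_imp_weights[of "?E - Y"] finite_nk_star_edges by blast
  let ?G = "delete_elems (nk_star_graph n k) X Y"
  have "(\<Sum>e | e \<in> edges ?G \<and> v \<in> e. g e) = 1" if v: "v \<in> verts ?G" for v
  proof -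
    \<comment> \<open>The edges that disappear with the vertices of \<open>X\<close> carry weight 0,
      as \<open>g\<close> is supported on edges inside \<open>?V - X\<close>.\<close>
    have "(\<Sum>e | e \<in> edges ?G \<and> v \<in> e. g e) = (\<Sum>e | e \<in> ?E - Y \<and> v \<in> e. g e)"
    proof (rule sum.mono_neutral_left)
      have "g e = 0" if "e \<inter> X \<noteq> {}" for e using that g(2) by blast
      then show "\<forall>e\<in>{e \<in> ?E - Y. v \<in> e} - {e \<in> edges ?G. v \<in> e}. g e = 0"
        by (auto simp: delete_elems_def)
    qed (use finite_nk_star_edges in \<open>auto simp: delete_elems_def\<close>)
    then show ?thesis using g(3) v by (simp add: delete_elems_def)
  qed
  then have "fractional_perfect_matching ?G g"
    using g(1) unfolding fractional_perfect_matching_def by blast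
  then show ?thesis unfolding has_fractional_perfect_matching_def by blast
qed

text \<open>There are \<open>k - 1\<close> swaps and \<open>n - k\<close> replacements at
  \<open>a\<close>. An upper bound is enough, because a smaller degree would contradict the lower
  bound on \<open>fmp\<close>.\<close>

lemma nk_star_degree_le:
  assumes a: "a \<in> nk_star_verts n k" and k: "1 \<le> k" "k \<le> n"
  shows "card {e \<in> edges (nk_star_graph n k). a \<in> e} \<le> n - 1"
proof -
  let ?A = "(\<lambda>s. {a, a[0 := a ! s, s := a ! 0]}) ` {1..<k}"
  let ?B = "(\<lambda>x. {a, a[0 := x]}) ` ({1..n} - set a)"
  have len: "length a = k" "distinct a" "set a \<subseteq> {1..n}" using a by (auto simp: nk_star_verts_def)
  have nbr: "{a, b} \<in> ?A \<union> ?B"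
    if b: "b \<in> nk_star_verts n k" and adj: "nk_star_adj k a b \<or> nk_star_adj k b a" for b
  proof -
    have lb: "length b = k" "distinct b" "set b \<subseteq> {1..n}" using b by (auto simp: nk_star_verts_def)
    have "(\<exists>s\<in>{1..<k}. b = a[0 := a ! s, s := a ! 0]) \<or> (\<exists>s\<in>{1..<k}. a = b[0 := b ! s, s := b ! 0]) \<or>
      (\<forall>i\<in>{1..<k}. a ! i = b ! i) \<and> a ! 0 \<noteq> b ! 0"
      using adj unfolding nk_star_adj_def by (elim disjE) simp_all
    then consider (swap) s where "s \<in> {1..<k}" "b = a[0 := a ! s, s := a ! 0]"
      | (swap') s where "s \<in> {1..<k}" "a = b[0 := b ! s, s := b ! 0]"
      | (replace) "\<forall>i\<in>{1..<k}. a ! i = b ! i" "a ! 0 \<noteq> b ! 0"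
      by (elim disjE bexE conjE)
    then show ?thesis
    proof cases
      case swap
      then show ?thesis by blast
    next
      \<comment> \<open>Swapping two positions is an involution.\<close>
      case swap'
      then have "b = a[0 := a ! s, s := a ! 0]"
        using lb by (intro nth_equalityI) (auto simp: nth_list_update)
      then show ?thesis using swap' by blast
    next
      case replace
      have "b = a[0 := b ! 0]"
        using replace lb len by (intro nth_equalityI) (auto simp: nth_list_update)
      moreover have "b ! 0 \<notin> set a"
      proof
        assume "b ! 0 \<in> set a"
        then obtain i where i: "i < k" "a ! i = b ! 0" using len by (auto simp: in_set_conv_nth)
        then have "i \<in> {1..<k}" using replace(2) by (cases i) auto
        then show False using replace(1) i lb by (auto simp: nth_eq_iff_index_eq)
      qed
      moreover have "0 < length b" using lb k by simp
      then have "b ! 0 \<in> {1..n}" using lb(3) nth_mem by blast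
      ultimately have "{a, b} \<in> ?B" by (intro image_eqI[of _ _ "b ! 0"]) simp_all
      then show ?thesis by (rule UnI2)
    qed
  qed
  have "{e \<in> edges (nk_star_graph n k). a \<in> e} \<subseteq> ?A \<union> ?B"
  proof
    fix e assume e: "e \<in> {e \<in> edges (nk_star_graph n k). a \<in> e}"
    then have "e \<in> edges (nk_star_graph n k)" by simp
    then obtain p q where pq: "e = {p, q}" "p \<in> nk_star_verts n k" "q \<in> nk_star_verts n k"
      "nk_star_adj k p q" by (rule nk_star_edgeE)
    consider "a = p" | "a = q" using e pq(1) by blast
    then show "e \<in> ?A \<union> ?B"
    proof cases
      case 1
      have "{a, q} \<in> ?A \<union> ?B" by (rule nbr) (use pq 1 in simp_all)
      then show ?thesis using pq(1) 1 by simp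
    next
      case 2
      have "{a, p} \<in> ?A \<union> ?B" by (rule nbr) (use pq 2 in simp_all)
      moreover have "e = {a, p}" using pq(1) 2 by auto
      ultimately show ?thesis by simp
    qed
  qed
  then have "card {e \<in> edges (nk_star_graph n k). a \<in> e} \<le> card (?A \<union> ?B)"
    by (intro card_mono) auto
  also have "\<dots> \<le> card ?A + card ?B" by (rule card_Un_le)
  also have "\<dots> \<le> card {1..<k} + card ({1..n} - set a)"
    by (intro add_mono card_image_le) auto
  also have "card ({1..n} - set a) = n - k"
    using len distinct_card[of a] by (subst card_Diff_subset) auto
  finally show ?thesis using k by simp
qed

text \<open>The vertex \<open>v\<close> stays, but its sum is now empty and cannot be 1.\<close>

lemma no_fractional_perfect_matching_isolated:
  assumes "v \<in> verts G"
  shows "\<not> has_fractional_perfect_matching (delete_elems G {} {e \<in> edges G. v \<in> e})"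
    (is "\<not> has_fractional_perfect_matching ?G")
proof
  assume "has_fractional_perfect_matching ?G"
  then obtain g where "\<forall>v\<in>verts ?G. (\<Sum>e | e \<in> edges ?G \<and> v \<in> e. g e) = (1 :: real)"
    unfolding has_fractional_perfect_matching_def fractional_perfect_matching_def by blast
  moreover have "v \<in> verts ?G" using assms by (simp add: delete_elems_def)
  ultimately have "(\<Sum>e | e \<in> edges ?G \<and> v \<in> e. g e) = 1" by (rule bspec)
  moreover have "{e. e \<in> edges ?G \<and> v \<in> e} = {}" by (auto simp: delete_elems_def)
  ultimately show False by (simp only: sum.empty zero_neq_one)
qed

theorem theorem4p31:
  fixes n k :: nat
  assumes "2 \<le> k" and "k + 2 \<le> n"
  shows "fsmp (nk_star_graph n k) = n - 1 \<and> fmp (nk_star_graph n k) = n - 1"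
proof -
  let ?G = "nk_star_graph n k"
  let ?P = "\<lambda>m. \<exists>F. F \<subseteq> verts ?G <+> edges ?G \<and> finite F \<and> card F = m \<and>
     \<not> has_fractional_perfect_matching (delete_elems ?G (Inl -` F) (Inr -` F))"
  let ?Q = "\<lambda>m. \<exists>F. F \<subseteq> edges ?G \<and> finite F \<and> card F = m \<and>
     \<not> has_fractional_perfect_matching (delete_elems ?G {} F)"
  \<comment> \<open>A smaller mixed fault set has at most \<open>n - 2\<close> elements and splits
    into its vertices and edges, so \<open>nk_star_few_faults\<close> applies.\<close>
  have P_ge: "n - 1 \<le> m" if "?P m" for m
  proof (rule ccontr)
    assume m: "\<not> n - 1 \<le> m"
    obtain F where F: "F \<subseteq> verts ?G <+> edges ?G" "finite F" "card F = m"
      "\<not> has_fractional_perfect_matching (delete_elems ?G (Inl -` F) (Inr -` F))"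
      using \<open>?P m\<close> by blast
    have fin: "finite (Inl -` F)" "finite (Inr -` F)"
      using F(2) by (auto intro: finite_vimageI)
    have "F = Inl -` F <+> Inr -` F"
    proof (rule set_eqI)
      show "z \<in> F \<longleftrightarrow> z \<in> Inl -` F <+> Inr -` F" for z by (cases z) auto
    qed
    then have "card F = card (Inl -` F) + card (Inr -` F)" using card_Plus[OF fin] by simp
    moreover have "Inr -` F \<subseteq> edges ?G" using F(1) by auto
    ultimately show False using nk_star_few_faults[OF assms _ fin(1)] F m by auto
  qed
  \<comment> \<open>An edge fault set is a mixed one without vertices, so the lower bound for mixed
    sets serves both minima.\<close>
  have Q_imp_P: "?P m" if Q: "?Q m" for m
  proof -
    obtain F where F: "F \<subseteq> edges ?G" "finite F" "card F = m"
      "\<not> has_fractional_perfect_matching (delete_elems ?G {} F)" using Q by blast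
    have "Inl -` (Inr ` F) = ({} :: nat list set)"
      "Inr -` (Inr ` F :: (nat list + nat list set) set) = F" by auto
    then show ?thesis
      using F by (intro exI[of _ "Inr ` F"]) (auto simp: card_image)
  qed
  have "map Suc [0..<k] \<in> nk_star_verts n k"
    using assms by (auto simp: nk_star_verts_def distinct_map)
  then obtain a where a: "a \<in> nk_star_verts n k" by blast
  define d where "d = card {e \<in> edges ?G. a \<in> e}"
  have "?Q d"
    using no_fractional_perfect_matching_isolated[of a ?G] a finite_nk_star_edges
    by (intro exI[of _ "{e \<in> edges ?G. a \<in> e}"]) (auto simp: d_def)
  moreover have "d \<le> n - 1" unfolding d_def using nk_star_degree_le[OF a] assms by simp
  \<comment> \<open>The degree \<open>d\<close> is at most \<open>n - 1\<close> by counting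
    neighbours and at least \<open>n - 1\<close> by \<open>P_ge\<close>, so isolating
    \<open>a\<close> takes exactly \<open>n - 1\<close> edges.\<close>
  ultimately have Q: "?Q (n - 1)" using P_ge[OF Q_imp_P, of d] by (metis le_antisym)
  have "fsmp ?G = n - 1"
    unfolding fsmp_def by (rule Least_equality[of ?P]) (use Q_imp_P[OF Q] P_ge in blast)+
  moreover have "fmp ?G = n - 1"
    unfolding fmp_def by (rule Least_equality[of ?Q]) (use Q Q_imp_P P_ge in blast)+
  ultimately show ?thesis by blast
qed

end
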